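(* Let $n\ge1$ and let $g:[0,1)\to\mathbb{R}$ be continuous with $g(0)=0$. Suppose $\Omega$ is an open set with compact closure in $\mathbb{B}^n$ and $f$ is nonnegative on $\Omega$ with $0<\int_\Omega f(y)(1-|y|^2)^{-n}\,dy<\infty$. If $\int_0^1 g(r)(1-r^2)^{-1}\,dr=\infty$, then a point $x\in\mathbb{B}^n$ exists such that each component of the vector field $v\circ T_x$ is orthogonal to $f$ with respect to the hyperbolic metric, meaning $$\int_\Omega v(T_x(y))\,f(y)\,(1-|y|^2)^{-n}\,dy=0.$$ If in addition $g$ is increasing with $g(r)>0$ whenever $0<r<1$, then the point $x$ is unique.
   Context: $\mathbb{B}^n$ is the open unit ball centered at the origin in $\mathbb{R}^n$, $\overline{\mathbb{B}^n}$ its closure, and $|\cdot|$ is the euclidean norm. For $x\in\mathbb{B}^n$ the M\"obius transformation $T_x:\overline{\mathbb{B}^n}\to\overline{\mathbb{B}^n}$ is $$T_x(y)=\frac{(1+2x\cdot y+|y|^2)x+(1-|x|^2)y}{1+2x\cdot y+|x|^2|y|^2},\qquad y\in\overline{\mathbb{B}^n}.$$ The radial vector field $v:\mathbb{B}^n\to\mathbb{R}^n$ is $v(y)=g(|y|)\,y/|y|$ for $y\neq 0$ and $v(0)=0$. The condition $\int_0^1 g(r)(1-r^2)^{-1}\,dr=\infty$ means $\int_0^\rho g(r)(1-r^2)^{-1}\,dr\to\infty$ as $\rho\to1^-$. "Increasing" means non-strictly increasing (nondecreasing). $dy$ is Lebesgue measure, and $(1-|y|^2)^{-n}$ is the volume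 factor on the hyperbolic ball.
   Formalization: In dimension n = 1 the uniqueness of x is claimed only for strictly increasing g, since with merely nondecreasing g it fails (e.g. g(r)=min(4r,1), Ω={1/2<|y|<3/4}, f=1−y²); for n ≥ 2, and for existence, nothing is changed. *)

theory Defs
  imports "HOL-Analysis.Analysis"
begin

definition moebius_map :: "real ^ 'n \<Rightarrow> real ^ 'n \<Rightarrow> real ^ 'n" where
  "moebius_map x y =
     (1 / (1 + 2 * (x \<bullet> y) + (norm x)\<^sup>2 * (norm y)\<^sup>2)) *\<^sub>R
     ((1 + 2 * (x \<bullet> y) + (norm y)\<^sup>2) *\<^sub>R x + (1 - (norm x)\<^sup>2) *\<^sub>R y)"

definition radial_field :: "(real \<Rightarrow> real) \<Rightarrow> real ^ 'n \<Rightarrow> real ^ 'n" where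
  "radial_field g y = (if y = 0 then 0 else g (norm y) *\<^sub>R (y /\<^sub>R norm y))"

text \<open>Density of the hyperbolic volume with respect to Lebesgue measure, on the unit ball
  with the metric \<open>\<bar>dy\<bar> / (1 - \<bar>y\<bar>\<^sup>2)\<close>.\<close>

definition hyp_density :: "real ^ 'n \<Rightarrow> real" where
  "hyp_density y = 1 / (1 - (norm y)\<^sup>2) ^ CARD('n)"

text \<open>For a merely nondecreasing profile \<open>g\<close>, uniqueness fails in dimension one: with
  \<open>g r = min (4 * r) 1\<close>, \<open>\<Omega> = {y. 1/2 < \<bar>y\<bar> \<and> \<bar>y\<bar> < 3/4}\<close> and \<open>f y = 1 - y\<^sup>2\<close>, the field
  \<open>radial_field g (moebius_map x y)\<close> equals \<open>sgn y\<close> on \<open>\<Omega>\<close> for all \<open>0 \<le> x \<le> 1/10\<close>, so its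
  integral vanishes for each such \<open>x\<close>. Hence uniqueness is stated with strict monotonicity
  when \<open>CARD('n) = 1\<close>.\<close>

end

(* The vector field x |-> integral of v(T_x y) f(y) dvol(y) is, up to the conformal factor 1 - |x|^2, the
   gradient of the energy E(x) = integral of G(|T_x y|) f(y) dvol(y), where G' r = g r / (1 - r^2).
   Since G tends to infinity at 1 and the support of f is compact in the ball, E attains a minimum,
   which is a zero of the field.

   For uniqueness one compares two zeros x, x': the directional derivative of G(d(-x, y)) along the
   geodesic through -x and -x' is nondecreasing, because the distance is convex and g is
   nondecreasing. By the hyperbolic cosine rule this reduces to an inequality between the three side
   lengths of the triangle -x, -x', y, which is strict unless y lies on the geodesic; that is a null
   set in dimension at least two, and strict monotonicity of g replaces this in dimension one. *)
theory Submission
  imports Defs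
begin

lemma moebius_denominator_ge:
  fixes x y :: "'a::real_inner"
  shows "(1 - norm x * norm y)\<^sup>2 \<le> 1 + 2 * (x \<bullet> y) + (norm x)\<^sup>2 * (norm y)\<^sup>2"
proof -
  have "- (norm x * norm y) \<le> x \<bullet> y"
    using Cauchy_Schwarz_ineq2[of x y] by linarith
  then show ?thesis
    by (simp add: power2_diff power_mult_distrib)
qed

lemma moebius_denominator_pos:
  fixes x y :: "'a::real_inner"
  assumes "norm x < 1" "norm y < 1"
  shows "0 < 1 + 2 * (x \<bullet> y) + (norm x)\<^sup>2 * (norm y)\<^sup>2"
proof -
  have "norm x * norm y < 1"
    using mult_strict_mono'[OF assms] by simp
  then have "0 < (1 - norm x * norm y)\<^sup>2"
    by simp
  then show ?thesis
    using moebius_denominator_ge[of x y] by linarith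
qed

lemma one_minus_norm_sq_pos: "norm x < 1 \<Longrightarrow> 0 < 1 - (norm x)\<^sup>2"
  by (simp add: abs_square_less_1)

lemma one_minus_norm_moebius_sq:
  fixes x y :: "real ^ 'n"
  assumes "norm x < 1" "norm y < 1"
  shows "1 - (norm (moebius_map x y))\<^sup>2 =
    (1 - (norm x)\<^sup>2) * (1 - (norm y)\<^sup>2) / (1 + 2 * (x \<bullet> y) + (norm x)\<^sup>2 * (norm y)\<^sup>2)"
proof -
  define D where "D = 1 + 2 * (x \<bullet> y) + (norm x)\<^sup>2 * (norm y)\<^sup>2"
  define w where "w = (1 + 2 * (x \<bullet> y) + (norm y)\<^sup>2) *\<^sub>R x + (1 - (norm x)\<^sup>2) *\<^sub>R y"
  have D: "D > 0"
    using moebius_denominator_pos[OF assms] by (simp add: D_def)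
  have "(norm w)\<^sup>2 = D\<^sup>2 - (1 - (norm x)\<^sup>2) * (1 - (norm y)\<^sup>2) * D"
    unfolding w_def D_def power2_norm_eq_inner
    by (simp add: inner_simps inner_commute[of y x]) algebra
  moreover have "moebius_map x y = (1 / D) *\<^sub>R w"
    by (simp add: moebius_map_def D_def w_def)
  ultimately have "1 - (norm (moebius_map x y))\<^sup>2 =
      1 - (D\<^sup>2 - (1 - (norm x)\<^sup>2) * (1 - (norm y)\<^sup>2) * D) / D\<^sup>2"
    using D by (simp add: power_divide)
  also have "\<dots> = (1 - (norm x)\<^sup>2) * (1 - (norm y)\<^sup>2) / D"
    using D by (simp add: field_simps power2_eq_square)
  finally show ?thesis
    by (simp add: D_def)
qed

lemma norm_moebius_less_1:
  fixes x y :: "real ^ 'n"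
  assumes "norm x < 1" "norm y < 1"
  shows "norm (moebius_map x y) < 1"
proof -
  have "0 < 1 - (norm (moebius_map x y))\<^sup>2"
    unfolding one_minus_norm_moebius_sq[OF assms]
    using assms moebius_denominator_pos[OF assms] one_minus_norm_sq_pos by (metis divide_pos_pos mult_pos_pos)
  then show ?thesis
    by (simp add: abs_square_less_1)
qed

lemma moebius_eq_0_iff:
  fixes x y :: "real ^ 'n"
  assumes "norm x < 1" "norm y < 1"
  shows "moebius_map x y = 0 \<longleftrightarrow> y = - x"
proof
  assume "y = - x"
  then show "moebius_map x y = 0"
    by (simp add: moebius_map_def power2_norm_eq_inner algebra_simps)
next
  define D where "D = 1 + 2 * (x \<bullet> y) + (norm x)\<^sup>2 * (norm y)\<^sup>2"
  assume "moebius_map x y = 0"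
  then have "D = (1 - (norm x)\<^sup>2) * (1 - (norm y)\<^sup>2)"
    using one_minus_norm_moebius_sq[OF assms] moebius_denominator_pos[OF assms]
    by (simp add: D_def field_simps)
  then have "(norm (x + y))\<^sup>2 = 0"
    unfolding D_def power2_norm_eq_inner by (simp add: inner_simps inner_commute[of y x] algebra_simps)
  then show "y = - x"
    by (simp add: eq_neg_iff_add_eq_0 add.commute)
qed

lemma has_real_derivative_norm_moebius_sq:
  fixes x y h :: "real ^ 'n"
  assumes "norm (x + t *\<^sub>R h) < 1" "norm y < 1"
  shows "((\<lambda>s. (norm (moebius_map (x + s *\<^sub>R h) y))\<^sup>2) has_real_derivative
    2 * (1 - (norm (moebius_map (x + t *\<^sub>R h) y))\<^sup>2) / (1 - (norm (x + t *\<^sub>R h))\<^sup>2) *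
      (moebius_map (x + t *\<^sub>R h) y \<bullet> h)) (at t)"
proof -
  define N where "N s = (norm (x + s *\<^sub>R h))\<^sup>2" for s
  define P where "P s = (x + s *\<^sub>R h) \<bullet> y" for s
  define D where "D s = 1 + 2 * P s + N s * (norm y)\<^sup>2" for s
  define z where "z = x + t *\<^sub>R h"
  have D: "D t \<noteq> 0" and z: "1 - (norm z)\<^sup>2 \<noteq> 0"
    using moebius_denominator_pos[OF assms] one_minus_norm_sq_pos[OF assms(1)]
    by (auto simp: D_def N_def P_def z_def)
  have dn: "(N has_real_derivative 2 * (z \<bullet> h)) (at t)"
  proof -
    have "N s = x \<bullet> x + 2 * s * (x \<bullet> h) + s\<^sup>2 * (h \<bullet> h)" for s
      unfolding N_def power2_norm_eq_inner
      by (simp add: inner_simps inner_commute[of h x] power2_eq_square algebra_simps)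
    moreover have "((\<lambda>s. x \<bullet> x + 2 * s * (x \<bullet> h) + s\<^sup>2 * (h \<bullet> h)) has_real_derivative 2 * (z \<bullet> h)) (at t)"
      by (auto intro!: derivative_eq_intros simp: z_def inner_simps)
    ultimately show ?thesis
      by presburger
  qed
  have di: "(P has_real_derivative (h \<bullet> y)) (at t)"
    unfolding P_def by (auto intro!: derivative_eq_intros simp: inner_simps)
  have dD: "(D has_real_derivative 2 * (h \<bullet> y) + 2 * (z \<bullet> h) * (norm y)\<^sup>2) (at t)"
    unfolding D_def by (auto intro!: derivative_eq_intros dn di)
  have Nt: "N t = (norm z)\<^sup>2"
    by (simp add: N_def z_def)
  have *: "((\<lambda>s. 1 - (1 - N s) * (1 - (norm y)\<^sup>2) / D s) has_real_derivative
      (2 * (z \<bullet> h) * (1 - (norm y)\<^sup>2) * D t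
        + (1 - (norm z)\<^sup>2) * (1 - (norm y)\<^sup>2) * (2 * (h \<bullet> y) + 2 * (z \<bullet> h) * (norm y)\<^sup>2)) / (D t * D t)) (at t)"
    using D by (auto intro!: derivative_eq_intros dn dD simp: Nt minus_divide_left)
  have eq: "2 * (z \<bullet> h) * (1 - (norm y)\<^sup>2) * D t
        + (1 - (norm z)\<^sup>2) * (1 - (norm y)\<^sup>2) * (2 * (h \<bullet> y) + 2 * (z \<bullet> h) * (norm y)\<^sup>2)
     = 2 * (1 - (norm y)\<^sup>2) * ((1 + 2 * (z \<bullet> y) + (norm y)\<^sup>2) * (z \<bullet> h) + (1 - (norm z)\<^sup>2) * (h \<bullet> y))"
    unfolding D_def N_def P_def z_def[symmetric] by algebra
  have T: "moebius_map z y \<bullet> h = ((1 + 2 * (z \<bullet> y) + (norm y)\<^sup>2) * (z \<bullet> h) + (1 - (norm z)\<^sup>2) * (h \<bullet> y)) / D t"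
    by (simp add: moebius_map_def D_def N_def P_def z_def[symmetric] inner_add_left inner_commute[of y h])
  have N: "2 * (1 - (norm y)\<^sup>2) / D t = 2 * (1 - (norm (moebius_map z y))\<^sup>2) / (1 - (norm z)\<^sup>2)"
    using one_minus_norm_moebius_sq[OF assms] z by (simp add: D_def N_def P_def z_def)
  have op: "open {s. norm (x + s *\<^sub>R h) < 1}"
    by (intro open_Collect_less continuous_intros)
  have "((\<lambda>s. (norm (moebius_map (x + s *\<^sub>R h) y))\<^sup>2) has_real_derivative
      2 * (1 - (norm y)\<^sup>2) / D t * (((1 + 2 * (z \<bullet> y) + (norm y)\<^sup>2) * (z \<bullet> h) + (1 - (norm z)\<^sup>2) * (h \<bullet> y)) / D t)) (at t)"
    unfolding times_divide_times_eq
  proof (rule has_field_derivative_transform_within_open[OF *[unfolded eq] op])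
    show "1 - (1 - N s) * (1 - (norm y)\<^sup>2) / D s = (norm (moebius_map (x + s *\<^sub>R h) y))\<^sup>2"
      if "s \<in> {s. norm (x + s *\<^sub>R h) < 1}" for s
      using one_minus_norm_moebius_sq[of "x + s *\<^sub>R h" y] that assms(2)
      by (simp add: D_def N_def P_def)
  qed (use assms in simp)
  then show ?thesis
    by (simp only: N T flip: z_def)
qed

section \<open>Cosine rule\<close>

text \<open>The metric has curvature \<open>- 4\<close>: \<open>hyp_cosh x y\<close> is the hyperbolic cosine of twice the
  distance between \<open>- x\<close> and \<open>y\<close>, and \<open>hyp_log x y\<close> is a vector in the direction of
  \<open>moebius_map x y\<close> whose length is the hyperbolic sine of the same number.\<close>

definition hyp_cosh :: "real ^ 'n \<Rightarrow> real ^ 'n \<Rightarrow> real" where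
  "hyp_cosh x y = ((1 + (norm x)\<^sup>2) * (1 + (norm y)\<^sup>2) + 4 * (x \<bullet> y)) /
     ((1 - (norm x)\<^sup>2) * (1 - (norm y)\<^sup>2))"

definition hyp_log :: "real ^ 'n \<Rightarrow> real ^ 'n \<Rightarrow> real ^ 'n" where
  "hyp_log x y = (2 / (1 - (norm (moebius_map x y))\<^sup>2)) *\<^sub>R moebius_map x y"

lemma hyp_log_eq:
  fixes x y :: "real ^ 'n"
  assumes "norm x < 1" "norm y < 1"
  shows "hyp_log x y = (2 / ((1 - (norm x)\<^sup>2) * (1 - (norm y)\<^sup>2))) *\<^sub>R
     ((1 + 2 * (x \<bullet> y) + (norm y)\<^sup>2) *\<^sub>R x + (1 - (norm x)\<^sup>2) *\<^sub>R y)"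
proof -
  define D where "D = 1 + 2 * (x \<bullet> y) + (norm x)\<^sup>2 * (norm y)\<^sup>2"
  have "D > 0"
    using moebius_denominator_pos[OF assms] by (simp add: D_def)
  moreover have "2 / (1 - (norm (moebius_map x y))\<^sup>2) = 2 / ((1 - (norm x)\<^sup>2) * (1 - (norm y)\<^sup>2)) * D"
    using one_minus_norm_moebius_sq[OF assms] by (simp flip: D_def)
  ultimately show ?thesis
    by (simp add: hyp_log_def moebius_map_def flip: D_def)
qed

lemma hyp_cosine_rule:
  fixes x y z :: "real ^ 'n"
  assumes "norm x < 1" "norm y < 1" "norm z < 1"
  shows "hyp_log x y \<bullet> hyp_log x z = hyp_cosh x y * hyp_cosh x z - hyp_cosh y (- z)"
proof -
  define a b e p q s where "a = (norm x)\<^sup>2" "b = (norm y)\<^sup>2" "e = (norm z)\<^sup>2"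
    "p = x \<bullet> y" "q = x \<bullet> z" "s = y \<bullet> z"
  note defs = this
  have nz: "1 - a \<noteq> 0" "1 - b \<noteq> 0" "1 - e \<noteq> 0"
    using assms[THEN one_minus_norm_sq_pos] by (auto simp: defs)
  have fraction: "(2 / (A * B)) * ((2 / (A * E)) * L) = X / (A * B) * (Y / (A * E)) - Z / (B * E)"
    if "4 * L = X * Y - A\<^sup>2 * Z" "A \<noteq> 0" "B \<noteq> 0" "E \<noteq> 0" for A B E L X Y Z :: real
  proof -
    have "(2 / (A * B)) * ((2 / (A * E)) * L) = (X * Y - A\<^sup>2 * Z) / (A * B * (A * E))"
      by (simp flip: that(1))
    then show ?thesis
      using that(2-) by (simp add: field_simps power2_eq_square)
  qed
  have "hyp_log x y \<bullet> hyp_log x z = (2 / ((1 - a) * (1 - b))) * ((2 / ((1 - a) * (1 - e))) *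
      ((1 + 2*p + b) * (1 + 2*q + e) * a + (1 + 2*p + b) * (1 - a) * q + (1 - a) * (1 + 2*q + e) * p + (1 - a) * (1 - a) * s))"
    unfolding hyp_log_eq[OF assms(1,2)] hyp_log_eq[OF assms(1,3)] inner_scaleR_left inner_scaleR_right
    unfolding inner_add_left inner_add_right inner_scaleR_left inner_scaleR_right
    by (simp add: defs power2_norm_eq_inner inner_commute[of y x] algebra_simps)
  also have "\<dots> = ((1 + a) * (1 + b) + 4 * p) / ((1 - a) * (1 - b)) * (((1 + a) * (1 + e) + 4 * q) / ((1 - a) * (1 - e)))
      - ((1 + b) * (1 + e) - 4 * s) / ((1 - b) * (1 - e))"
  proof (rule fraction)
    show "4 * ((1 + 2*p + b) * (1 + 2*q + e) * a + (1 + 2*p + b) * (1 - a) * q + (1 - a) * (1 + 2*q + e) * p + (1 - a) * (1 - a) * s)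
      = ((1 + a) * (1 + b) + 4 * p) * ((1 + a) * (1 + e) + 4 * q) - (1 - a)\<^sup>2 * ((1 + b) * (1 + e) - 4 * s)"
      by algebra
  qed (use nz in auto)
  finally show ?thesis
    by (simp add: hyp_cosh_def defs)
qed

lemma hyp_cosh_minus_self:
  fixes y :: "real ^ 'n"
  assumes "norm y < 1"
  shows "hyp_cosh y (- y) = 1"
proof -
  have "(1 + (norm y)\<^sup>2) * (1 + (norm y)\<^sup>2) - 4 * (norm y)\<^sup>2 = (1 - (norm y)\<^sup>2) * (1 - (norm y)\<^sup>2)"
    by algebra
  then show ?thesis
    using one_minus_norm_sq_pos[OF assms] by (simp add: hyp_cosh_def power2_norm_eq_inner)
qed

lemma norm_hyp_log_sq:
  fixes x y :: "real ^ 'n"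
  assumes "norm x < 1" "norm y < 1"
  shows "(norm (hyp_log x y))\<^sup>2 = (hyp_cosh x y)\<^sup>2 - 1"
  unfolding power2_norm_eq_inner
  using hyp_cosine_rule[OF assms assms(2)] hyp_cosh_minus_self[OF assms(2)]
  by (simp add: power2_eq_square)

lemma hyp_cosh_eq:
  fixes x y :: "real ^ 'n"
  assumes "norm x < 1" "norm y < 1"
  shows "hyp_cosh x y = 2 / (1 - (norm (moebius_map x y))\<^sup>2) - 1"
proof -
  define D where "D = 1 + 2 * (x \<bullet> y) + (norm x)\<^sup>2 * (norm y)\<^sup>2"
  define K where "K = (1 - (norm x)\<^sup>2) * (1 - (norm y)\<^sup>2)"
  have "K > 0"
    using assms[THEN one_minus_norm_sq_pos] by (simp only: K_def mult_pos_pos)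
  moreover have "(1 + (norm x)\<^sup>2) * (1 + (norm y)\<^sup>2) + 4 * (x \<bullet> y) = 2 * D - K"
    unfolding D_def K_def by algebra
  ultimately show ?thesis
    unfolding one_minus_norm_moebius_sq[OF assms] hyp_cosh_def
    by (simp add: diff_divide_distrib flip: D_def K_def)
qed

lemma hyp_cosh_gt_1:
  fixes x y :: "real ^ 'n"
  assumes "norm x < 1" "norm y < 1" "y \<noteq> - x"
  shows "1 < hyp_cosh x y"
proof -
  have "0 < (norm (moebius_map x y))\<^sup>2"
    using moebius_eq_0_iff[OF assms(1,2)] assms(3) by simp
  moreover have "0 < 1 - (norm (moebius_map x y))\<^sup>2"
    using norm_moebius_less_1[OF assms(1,2)] one_minus_norm_sq_pos by blast
  ultimately show ?thesis
    unfolding hyp_cosh_eq[OF assms(1,2)] by (simp add: field_simps)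
qed

lemma hyp_cosh_less_iff:
  fixes x x' y :: "real ^ 'n"
  assumes "norm x < 1" "norm x' < 1" "norm y < 1"
  shows "hyp_cosh x y < hyp_cosh x' y \<longleftrightarrow> norm (moebius_map x y) < norm (moebius_map x' y)"
proof -
  let ?N = "(norm (moebius_map x y))\<^sup>2" and ?N' = "(norm (moebius_map x' y))\<^sup>2"
  have "0 < 1 - ?N" "0 < 1 - ?N'"
    using norm_moebius_less_1 one_minus_norm_sq_pos assms by blast+
  then have "hyp_cosh x y < hyp_cosh x' y \<longleftrightarrow> ?N < ?N'"
    unfolding hyp_cosh_eq[OF assms(1,3)] hyp_cosh_eq[OF assms(2,3)]
    by (simp add: field_simps)
  then show ?thesis
    by (metis norm_ge_zero power_less_imp_less_base power_strict_mono zero_less_numeral)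
qed

lemma hyp_cosh_commute: "hyp_cosh x y = hyp_cosh y x"
  by (simp add: hyp_cosh_def inner_commute mult.commute)

lemma hyp_cosh_minus: "hyp_cosh (- x) y = hyp_cosh x (- y)"
  by (simp add: hyp_cosh_def)

lemma radial_field_moebius_inner:
  fixes x y w :: "real ^ 'n"
  assumes "norm x < 1" "norm y < 1"
  shows "radial_field g (moebius_map x y) \<bullet> w =
    g (norm (moebius_map x y)) * ((hyp_log x y \<bullet> w) / sqrt ((hyp_cosh x y)\<^sup>2 - 1))"
proof -
  let ?T = "moebius_map x y"
  define k where "k = 2 / (1 - (norm ?T)\<^sup>2)"
  have "k > 0"
    using one_minus_norm_sq_pos[OF norm_moebius_less_1[OF assms]] by (simp add: k_def)
  moreover have "sqrt ((hyp_cosh x y)\<^sup>2 - 1) = norm (hyp_log x y)"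
    by (simp flip: norm_hyp_log_sq[OF assms])
  moreover have "hyp_log x y = k *\<^sub>R ?T"
    by (simp add: hyp_log_def k_def)
  ultimately show ?thesis
    by (simp add: radial_field_def divide_inverse)
qed

text \<open>With \<open>C = cosh a\<close> and \<open>C' = cosh b\<close>, the hypothesis \<open>gram\<close> says \<open>cosh (a - b) \<le> c \<le> cosh (a + b)\<close>.\<close>

lemma triangle_monotone_ineq:
  fixes c C C' u u' :: real
  assumes c: "1 < c" and C: "1 < C" and C': "1 < C'"
    and gram: "(C * C' - c)\<^sup>2 \<le> (C\<^sup>2 - 1) * (C'\<^sup>2 - 1)"
    and u: "0 < u" "0 < u'"
    and mono: "C < C' \<Longrightarrow> u \<le> u'" "C' < C \<Longrightarrow> u' \<le> u"
    and strict: "(C * C' - c)\<^sup>2 < (C\<^sup>2 - 1) * (C'\<^sup>2 - 1) \<or> (C < C' \<longrightarrow> u < u') \<and> (C' < C \<longrightarrow> u' < u)"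
  shows "0 < u * ((c * C - C') / sqrt (C\<^sup>2 - 1)) + u' * ((c * C' - C) / sqrt (C'\<^sup>2 - 1))"
proof -
  define p q where "p = sqrt (C\<^sup>2 - 1)" and "q = sqrt (C'\<^sup>2 - 1)"
  have "1 < C\<^sup>2" "1 < C'\<^sup>2"
    using C C' by (simp_all add: one_less_power)
  then have pq: "p > 0" "q > 0" and sq: "p\<^sup>2 = C\<^sup>2 - 1" "q\<^sup>2 = C'\<^sup>2 - 1"
    by (simp_all add: p_def q_def)
  define A B where "A = (c * C - C') / p" and "B = (c * C' - C) / q"
  have AB: "A * p = c * C - C'" "B * q = c * C' - C"
    using pq by (simp_all add: A_def B_def)
  have "(A + B) * (p * q) = (A * p) * q + (B * q) * p"
    by algebra
  also have "\<dots> = (C * q + C' * p) * (c - (C * C' - p * q))"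
  proof -
    have "C' * q * p\<^sup>2 = C' * q * (C\<^sup>2 - 1)" "C * p * q\<^sup>2 = C * p * (C'\<^sup>2 - 1)"
      by (simp_all add: sq)
    then show ?thesis
      unfolding AB by (simp add: algebra_simps power2_eq_square)
  qed
  finally have sum: "(A + B) * (p * q) = (C * q + C' * p) * (c - (C * C' - p * q))" .
  have pos: "0 < C * q + C' * p" "0 < p * q"
    using pq C C' by (auto intro!: add_pos_pos mult_pos_pos)
  have "(C * C' - c)\<^sup>2 \<le> (p * q)\<^sup>2"
    using gram by (simp add: power_mult_distrib sq)
  then have "C * C' - c \<le> p * q"
    using pos(2) by (simp add: abs_le_square_iff[symmetric] abs_le_iff)
  then have "0 \<le> (A + B) * (p * q)"
    unfolding sum using pos(1) by simp
  then have AB0: "0 \<le> A + B"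
    using pos(2) by (simp add: zero_le_mult_iff)
  have strict': "0 < A + B \<or> (C < C' \<longrightarrow> u < u') \<and> (C' < C \<longrightarrow> u' < u)"
    using strict
  proof
    assume "(C * C' - c)\<^sup>2 < (C\<^sup>2 - 1) * (C'\<^sup>2 - 1)"
    then have "(C * C' - c)\<^sup>2 < (p * q)\<^sup>2"
      by (simp add: power_mult_distrib sq)
    then have "C * C' - c < p * q"
      using pos(2) by (simp add: power2_less_imp_less)
    then have "0 < (A + B) * (p * q)"
      unfolding sum using pos(1) by simp
    then show ?thesis
      using pos(2) by (simp add: zero_less_mult_iff)
  qed blast
  have key: "0 < u * A + u' * B"
    if "A \<le> 0" "C < C'" "0 \<le> A + B" "0 < A + B \<or> u < u'" "u \<le> u'" "0 < u" "0 < B" for A B C C' u u' :: real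
  proof -
    have *: "u * A + u' * B = u * (A + B) + (u' - u) * B"
      by algebra
    show ?thesis
      unfolding * using that by (auto intro: add_pos_nonneg add_nonneg_pos)
  qed
  have less: "C < C'" "0 < B" if "A \<le> 0"
  proof -
    have "c * C \<le> C'"
      using that pq AB(1) by (smt (verit) mult_nonneg_nonneg mult_nonpos_nonneg)
    moreover have "C < c * C"
      using c C by simp
    ultimately show "C < C'"
      by simp
    then have "C < c * C'"
      using c C' by (smt (verit) mult_le_cancel_right1)
    then show "0 < B"
      using pq by (simp add: B_def)
  qed
  have less': "C' < C" "0 < A" if "B \<le> 0"
  proof -
    have "c * C' \<le> C"
      using that pq AB(2) by (smt (verit) mult_nonneg_nonneg mult_nonpos_nonneg)
    moreover have "C' < c * C'"
      using c C' by simp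
    ultimately show "C' < C"
      by simp
    then have "C' < c * C"
      using c C by (smt (verit) mult_le_cancel_right1)
    then show "0 < A"
      using pq by (simp add: A_def)
  qed
  have "0 < u * A + u' * B"
  proof (cases "A \<le> 0")
    case True
    then show ?thesis
      using key[of A C C' B u u'] less AB0 strict' mono u by blast
  next
    case False
    show ?thesis
    proof (cases "B \<le> 0")
      case True
      then show ?thesis
        using key[of B C' C A u' u] less' AB0 strict' mono u by (simp add: add.commute)
    next
      case False
      then show ?thesis
        using \<open>\<not> A \<le> 0\<close> u by (simp add: add_pos_pos)
    qed
  qed
  then show ?thesis
    by (simp add: A_def B_def p_def q_def)
qed

lemma continuous_on_moebius_map:
  "continuous_on (ball 0 1 \<times> ball 0 1) (\<lambda>(x :: real ^ 'n, y). moebius_map x y)"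
proof -
  have "1 + 2 * (fst p \<bullet> snd p) + (norm (fst p))\<^sup>2 * (norm (snd p))\<^sup>2 \<noteq> 0"
    if "p \<in> ball 0 1 \<times> ball 0 1" for p :: "(real ^ 'n) \<times> (real ^ 'n)"
    using moebius_denominator_pos[of "fst p" "snd p"] that by (auto simp: mem_Times_iff)
  then show ?thesis
    unfolding case_prod_beta moebius_map_def by (intro continuous_intros) auto
qed

lemma continuous_on_moebius_map_compose:
  fixes p q :: "'a::topological_space \<Rightarrow> real ^ 'n"
  assumes "continuous_on A p" "continuous_on A q"
    and "\<And>a. a \<in> A \<Longrightarrow> norm (p a) < 1" "\<And>a. a \<in> A \<Longrightarrow> norm (q a) < 1"
  shows "continuous_on A (\<lambda>a. moebius_map (p a) (q a))"
proof -
  have "(\<lambda>a. (p a, q a)) ` A \<subseteq> ball 0 1 \<times> ball 0 1"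
    using assms(3,4) by auto
  from continuous_on_compose2[OF continuous_on_moebius_map continuous_on_Pair[OF assms(1,2)] this]
  show ?thesis
    by simp
qed

lemma continuous_on_radial_field:
  assumes cont: "continuous_on {0..<1} g" and "g 0 = 0"
  shows "continuous_on (ball 0 1) (radial_field g :: real ^ 'n \<Rightarrow> _)"
proof -
  have gn: "continuous_on (ball 0 1) (\<lambda>y :: real ^ 'n. g (norm y))"
    by (rule continuous_on_compose2[OF cont]) (auto intro!: continuous_intros)
  have "isCont (radial_field g) z" if z: "z \<in> ball 0 1" for z :: "real ^ 'n"
  proof (cases "z = 0")
    case True
    have "isCont (\<lambda>y :: real ^ 'n. g (norm y)) 0"
      using gn by (simp add: continuous_on_eq_continuous_at)
    then have "((\<lambda>y :: real ^ 'n. g (norm y)) \<longlongrightarrow> 0) (at 0)"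
      using \<open>g 0 = 0\<close> by (simp add: isCont_def)
    moreover have "norm (radial_field g y) = norm (g (norm y))" for y :: "real ^ 'n"
      using \<open>g 0 = 0\<close> by (simp add: radial_field_def abs_mult)
    ultimately have "((\<lambda>y :: real ^ 'n. norm (radial_field g y)) \<longlongrightarrow> 0) (at 0)"
      by (simp only: tendsto_norm_zero)
    then have "((radial_field g :: real ^ 'n \<Rightarrow> _) \<longlongrightarrow> 0) (at 0)"
      by (rule tendsto_norm_zero_cancel)
    then show ?thesis
      by (simp add: True isCont_def radial_field_def[of g 0])
  next
    case False
    have "continuous_on (ball 0 1 - {0}) (\<lambda>y :: real ^ 'n. g (norm y) *\<^sub>R (y /\<^sub>R norm y))"
      using gn by (intro continuous_intros) (auto intro: continuous_on_subset)
    then have "continuous_on (ball 0 1 - {0}) (radial_field g :: real ^ 'n \<Rightarrow> _)"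
      by (rule continuous_on_eq) (auto simp: radial_field_def)
    then show ?thesis
      using z False by (simp add: continuous_on_eq_continuous_at open_Diff)
  qed
  then show ?thesis
    by (simp add: continuous_at_imp_continuous_on)
qed

section \<open>The potential\<close>

definition hyp_potential :: "(real \<Rightarrow> real) \<Rightarrow> real \<Rightarrow> real" where
  "hyp_potential g \<rho> = integral {0..\<rho>} (\<lambda>r. g r / (1 - r\<^sup>2))"

lemma has_real_derivative_hyp_potential_within:
  assumes cont: "continuous_on {0..<1} g" and "0 \<le> r" "r \<le> b" "b < 1"
  shows "(hyp_potential g has_real_derivative g r / (1 - r\<^sup>2)) (at r within {0..b})"
proof -
  have "1 - s\<^sup>2 \<noteq> 0" if "s \<in> {0..b}" for s
    using one_minus_norm_sq_pos[of s] that assms by auto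
  then have "continuous_on {0..b} (\<lambda>r. g r / (1 - r\<^sup>2))"
    using assms by (intro continuous_intros continuous_on_subset[OF cont]) auto
  then show ?thesis
    unfolding hyp_potential_def using assms by (intro integral_has_real_derivative) auto
qed

lemma has_real_derivative_hyp_potential:
  assumes cont: "continuous_on {0..<1} g" and "0 < r" "r < 1"
  shows "(hyp_potential g has_real_derivative g r / (1 - r\<^sup>2)) (at r)"
proof -
  have "at r within {0..(1 + r) / 2} = at r"
    using assms by (intro at_within_Icc_at) auto
  then show ?thesis
    using has_real_derivative_hyp_potential_within[OF cont, of r "(1 + r) / 2"] assms by simp
qed

lemma continuous_on_hyp_potential:
  assumes cont: "continuous_on {0..<1} g"
  shows "continuous_on {0..<1} (hyp_potential g)"
  unfolding continuous_on_eq_continuous_within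
proof
  fix r :: real assume r: "r \<in> {0..<1}"
  let ?b = "(1 + r) / 2"
  have "at r within {0..<1} = at r within {0..?b}"
    using r by (intro at_within_nhd[of r "{..<?b}"]) auto
  moreover have "continuous (at r within {0..?b}) (hyp_potential g)"
    using has_real_derivative_hyp_potential_within[OF cont, of r ?b] r
    by (intro DERIV_continuous) auto
  ultimately show "continuous (at r within {0..<1}) (hyp_potential g)"
    by simp
qed

lemma has_real_derivative_hyp_potential_moebius:
  fixes x y h :: "real ^ 'n"
  assumes cont: "continuous_on {0..<1} g"
    and z: "norm (x + t *\<^sub>R h) < 1" and y: "norm y < 1"
    and nz: "moebius_map (x + t *\<^sub>R h) y \<noteq> 0"
  shows "((\<lambda>s. hyp_potential g (norm (moebius_map (x + s *\<^sub>R h) y))) has_real_derivative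
    (radial_field g (moebius_map (x + t *\<^sub>R h) y) \<bullet> h) / (1 - (norm (x + t *\<^sub>R h))\<^sup>2)) (at t)"
proof -
  define T where "T = moebius_map (x + t *\<^sub>R h) y"
  have T: "0 < norm T" "norm T < 1" "1 - (norm T)\<^sup>2 \<noteq> 0"
    using nz norm_moebius_less_1[OF z y] one_minus_norm_sq_pos[of T] by (auto simp: T_def)
  have "((\<lambda>s. sqrt ((norm (moebius_map (x + s *\<^sub>R h) y))\<^sup>2)) has_real_derivative
     inverse (sqrt ((norm T)\<^sup>2)) / 2 * (2 * (1 - (norm T)\<^sup>2) / (1 - (norm (x + t *\<^sub>R h))\<^sup>2) * (T \<bullet> h))) (at t)"
    unfolding T_def
    using T(1) DERIV_chain2[OF DERIV_real_sqrt has_real_derivative_norm_moebius_sq[OF z y]]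
    by (simp add: T_def)
  then have "((\<lambda>s. norm (moebius_map (x + s *\<^sub>R h) y)) has_real_derivative
     inverse (norm T) / 2 * (2 * (1 - (norm T)\<^sup>2) / (1 - (norm (x + t *\<^sub>R h))\<^sup>2) * (T \<bullet> h))) (at t)"
    by (simp only: real_sqrt_abs abs_norm_cancel)
  from DERIV_chain2[OF has_real_derivative_hyp_potential[OF cont T(1,2), unfolded T_def] this]
  have *: "((\<lambda>s. hyp_potential g (norm (moebius_map (x + s *\<^sub>R h) y))) has_real_derivative
    g (norm T) / (1 - (norm T)\<^sup>2) *
    (inverse (norm T) / 2 * (2 * (1 - (norm T)\<^sup>2) / (1 - (norm (x + t *\<^sub>R h))\<^sup>2) * (T \<bullet> h)))) (at t)"
    by (simp only: T_def)
  have cancel: "u / a * (v / 2 * (2 * a / b * w)) = u * (v * w) / b" if "a \<noteq> 0" for a b u v w :: real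
    using that by simp
  have "radial_field g T \<bullet> h = g (norm T) * (inverse (norm T) * (T \<bullet> h))"
    using T(1) by (simp add: radial_field_def)
  then show ?thesis
    using *[unfolded cancel[OF T(3)]] by (simp only: T_def)
qed

section \<open>Weighted integrals\<close>

lemma set_integrable_scaleR_continuous:
  fixes F :: "'a::euclidean_space \<Rightarrow> real" and h :: "'a \<Rightarrow> 'b::euclidean_space"
  assumes F: "set_integrable lebesgue \<Omega> F" and K: "compact K" "\<Omega> \<subseteq> K" and h: "continuous_on K h"
  shows "set_integrable lebesgue \<Omega> (\<lambda>y. F y *\<^sub>R h y)"
proof -
  obtain B where B: "\<And>y. y \<in> K \<Longrightarrow> norm (h y) \<le> B"
    using compact_imp_bounded[OF compact_continuous_image[OF h K(1)]] by (auto simp: bounded_iff)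
  have hm: "(\<lambda>y. indicator K y *\<^sub>R h y) \<in> borel_measurable lebesgue"
    using borel_measurable_continuous_on_indicator[OF borel_compact[OF K(1)] h]
    by (intro measurable_completion) simp
  have eq: "indicator \<Omega> y *\<^sub>R (F y *\<^sub>R h y) = (indicator \<Omega> y *\<^sub>R F y) *\<^sub>R (indicator K y *\<^sub>R h y)" for y
    using K(2) by (auto simp: indicator_def)
  have "(\<lambda>y. indicator \<Omega> y *\<^sub>R F y) \<in> borel_measurable lebesgue"
    using F by (simp only: set_integrable_def borel_measurable_integrable)
  then have "set_borel_measurable lebesgue \<Omega> (\<lambda>y. F y *\<^sub>R h y)"
    unfolding set_borel_measurable_def eq using hm by (rule borel_measurable_scaleR)
  moreover have "norm (F y *\<^sub>R h y) \<le> norm (B * F y)" if "y \<in> \<Omega>" for y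
    using mult_right_mono[OF order_trans[OF B[of y] abs_ge_self], of "\<bar>F y\<bar>"] that K(2)
    by (auto simp: abs_mult mult.commute)
  ultimately show ?thesis
    by (intro set_integrable_bound[OF set_integrable_mult_right[OF F, of B]] AE_I2 impI)
qed

lemma set_integral_inner_left:
  fixes h :: "'a \<Rightarrow> 'b::euclidean_space"
  assumes "set_integrable M A h"
  shows "(LINT y:A|M. h y \<bullet> c) = (LINT y:A|M. h y) \<bullet> c" "set_integrable M A (\<lambda>y. h y \<bullet> c)"
proof -
  have int: "integrable M (\<lambda>y. indicator A y *\<^sub>R h y)"
    using assms by (simp only: set_integrable_def)
  show "(LINT y:A|M. h y \<bullet> c) = (LINT y:A|M. h y) \<bullet> c"
    using integral_inner_left[OF int, of c]
    by (simp only: set_lebesgue_integral_def inner_scaleR_left real_scaleR_def)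
  show "set_integrable M A (\<lambda>y. h y \<bullet> c)"
    using integrable_inner_left[OF int, of c]
    by (simp only: set_integrable_def inner_scaleR_left real_scaleR_def)
qed

lemma continuous_on_weighted_integral:
  fixes F :: "'a::euclidean_space \<Rightarrow> real" and h :: "'b::metric_space \<Rightarrow> 'a \<Rightarrow> real"
  assumes F: "set_integrable lebesgue \<Omega> F" "\<And>y. y \<in> \<Omega> \<Longrightarrow> 0 \<le> F y"
    and K: "compact K" "\<Omega> \<subseteq> K" and X: "compact X"
    and h: "continuous_on (X \<times> K) (\<lambda>(x, y). h x y)"
  shows "continuous_on X (\<lambda>x. LINT y:\<Omega>|lebesgue. F y * h x y)"
  unfolding continuous_on_iff
proof (intro ballI allI impI)
  fix x and e :: real assume x: "x \<in> X" and e: "0 < e"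
  define I where "I = (LINT y:\<Omega>|lebesgue. F y)"
  have "0 \<le> I"
    unfolding I_def set_lebesgue_integral_def using F(2) by (intro Bochner_Integration.integral_nonneg) (auto simp: indicator_def)
  define e' where "e' = e / (I + 1)"
  have e': "0 < e'" "e' * I < e"
    using e \<open>0 \<le> I\<close> by (simp_all add: e'_def pos_divide_less_eq mult.commute)
  have int: "set_integrable lebesgue \<Omega> (\<lambda>y. F y * h x y)" if "x \<in> X" for x
  proof -
    have "continuous_on K (\<lambda>y. (x, y))" "(\<lambda>y. (x, y)) ` K \<subseteq> X \<times> K"
      using that by (auto intro!: continuous_intros)
    from continuous_on_compose2[OF h this] have "continuous_on K (h x)"
      by simp
    from set_integrable_scaleR_continuous[OF F(1) K this] show ?thesis
      by (simp only: real_scaleR_def)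
  qed
  obtain d where d: "d > 0" "\<And>p q. p \<in> X \<times> K \<Longrightarrow> q \<in> X \<times> K \<Longrightarrow> dist q p < d \<Longrightarrow>
      dist ((\<lambda>(x, y). h x y) q) ((\<lambda>(x, y). h x y) p) < e'"
    using compact_uniformly_continuous[OF h compact_Times[OF X K(1)]] e'(1)
    unfolding uniformly_continuous_on_def by metis
  have "dist (LINT y:\<Omega>|lebesgue. F y * h x' y) (LINT y:\<Omega>|lebesgue. F y * h x y) < e"
    if x': "x' \<in> X" "dist x' x < d" for x'
  proof -
    have "\<bar>h x' y - h x y\<bar> \<le> e'" if "y \<in> \<Omega>" for y
      using d(2)[of "(x, y)" "(x', y)"] x x' that K(2) by (auto simp: dist_Pair_Pair dist_real_def)
    then have *: "\<bar>F y * h x' y - F y * h x y\<bar> \<le> e' * F y" if "y \<in> \<Omega>" for y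
      using mult_left_mono[of "\<bar>h x' y - h x y\<bar>" e' "F y"] F(2)[of y] that
      by (simp add: abs_mult right_diff_distrib[symmetric] mult.commute)
    note ints = int[OF x'(1)] int[OF x]
    have "(LINT y:\<Omega>|lebesgue. F y * h x' y - F y * h x y) \<le> (LINT y:\<Omega>|lebesgue. e' * F y)"
      using * by (intro set_integral_mono set_integral_diff(1) ints set_integrable_mult_right F(1)) (auto simp: abs_le_iff)
    moreover have "(LINT y:\<Omega>|lebesgue. F y * h x y - F y * h x' y) \<le> (LINT y:\<Omega>|lebesgue. e' * F y)"
      using * by (intro set_integral_mono set_integral_diff(1) ints set_integrable_mult_right F(1)) (auto simp: abs_le_iff)
    moreover have "(LINT y:\<Omega>|lebesgue. e' * F y) < e"
      using e'(2) by (simp add: I_def)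
    ultimately show ?thesis
      unfolding set_integral_diff(2)[OF ints] set_integral_diff(2)[OF ints(2,1)] dist_real_def by linarith
  qed
  then show "\<exists>d>0. \<forall>x'\<in>X. dist x' x < d \<longrightarrow>
      dist (LINT y:\<Omega>|lebesgue. F y * h x' y) (LINT y:\<Omega>|lebesgue. F y * h x y) < e"
    using d(1) by blast
qed

section \<open>Existence\<close>

locale hyperbolic_weight =
  fixes g :: "real \<Rightarrow> real" and F :: "real ^ 'n \<Rightarrow> real" and \<Omega> K :: "(real ^ 'n) set"
  assumes cont_g: "continuous_on {0..<1} g" and g_0: "g 0 = 0"
    and compact_K: "compact K" and K_subset: "K \<subseteq> ball 0 1" and Omega_subset: "\<Omega> \<subseteq> K"
    and F_int: "set_integrable lebesgue \<Omega> F"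
    and F_nonneg: "\<And>y. y \<in> \<Omega> \<Longrightarrow> 0 \<le> F y"
    and F_pos: "0 < (LINT y:\<Omega>|lebesgue. F y)"
begin

definition potential :: "real ^ 'n \<Rightarrow> real ^ 'n \<Rightarrow> real" where
  "potential x y = hyp_potential g (norm (moebius_map x y))"

definition energy :: "real ^ 'n \<Rightarrow> real" where
  "energy x = (LINT y:\<Omega>|lebesgue. F y * potential x y)"

definition force :: "real ^ 'n \<Rightarrow> real ^ 'n" where
  "force x = (LINT y:\<Omega>|lebesgue. F y *\<^sub>R radial_field g (moebius_map x y))"

lemma norm_K: "y \<in> K \<Longrightarrow> norm y < 1"
  using K_subset by auto

lemma continuous_on_potential_compose:
  fixes p q :: "'a::topological_space \<Rightarrow> real ^ 'n"
  assumes "continuous_on A p" "continuous_on A q"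
    and "\<And>a. a \<in> A \<Longrightarrow> norm (p a) < 1" "\<And>a. a \<in> A \<Longrightarrow> norm (q a) < 1"
  shows "continuous_on A (\<lambda>a. potential (p a) (q a))"
proof -
  have "continuous_on A (\<lambda>a. norm (moebius_map (p a) (q a)))"
    by (intro continuous_on_norm continuous_on_moebius_map_compose assms)
  moreover have "(\<lambda>a. norm (moebius_map (p a) (q a))) ` A \<subseteq> {0..<1}"
    using assms(3,4) by (auto intro!: norm_moebius_less_1)
  ultimately show ?thesis
    unfolding potential_def by (rule continuous_on_compose2[OF continuous_on_hyp_potential[OF cont_g]])
qed

lemma continuous_on_field_compose:
  fixes p q :: "'a::topological_space \<Rightarrow> real ^ 'n"
  assumes "continuous_on A p" "continuous_on A q"
    and "\<And>a. a \<in> A \<Longrightarrow> norm (p a) < 1" "\<And>a. a \<in> A \<Longrightarrow> norm (q a) < 1"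
  shows "continuous_on A (\<lambda>a. radial_field g (moebius_map (p a) (q a)))"
proof -
  have "(\<lambda>a. moebius_map (p a) (q a)) ` A \<subseteq> ball 0 1"
    using assms(3,4) by (auto intro!: norm_moebius_less_1)
  from continuous_on_compose2[OF continuous_on_radial_field[OF cont_g g_0]
      continuous_on_moebius_map_compose[OF assms] this]
  show ?thesis .
qed

lemma set_integrable_field:
  assumes "norm x < 1"
  shows "set_integrable lebesgue \<Omega> (\<lambda>y. F y *\<^sub>R radial_field g (moebius_map x y))"
  using assms norm_K
  by (intro set_integrable_scaleR_continuous[OF F_int compact_K Omega_subset]
      continuous_on_field_compose continuous_on_const continuous_on_id) auto

lemma set_integrable_mult_continuous:
  assumes "continuous_on K h"
  shows "set_integrable lebesgue \<Omega> (\<lambda>y. F y * h y)"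
  using set_integrable_scaleR_continuous[OF F_int compact_K Omega_subset assms]
  by (simp only: real_scaleR_def)

lemma set_integrable_potential:
  assumes "norm x < 1"
  shows "set_integrable lebesgue \<Omega> (\<lambda>y. F y * potential x y)"
  using assms norm_K
  by (intro set_integrable_mult_continuous
      continuous_on_potential_compose continuous_on_const continuous_on_id) auto

lemma continuous_on_energy:
  assumes "r < 1"
  shows "continuous_on (cball 0 r) energy"
  unfolding energy_def
proof (rule continuous_on_weighted_integral[OF F_int F_nonneg compact_K Omega_subset compact_cball])
  show "continuous_on (cball 0 r \<times> K) (\<lambda>(x, y). potential x y)"
    unfolding case_prod_beta using assms norm_K
    by (intro continuous_on_potential_compose continuous_intros) auto
qed

lemma energy_coercive:
  assumes "filterlim (hyp_potential g) at_top (at_left 1)"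
  obtains r where "0 \<le> r" "r < 1" "\<And>x. r < norm x \<Longrightarrow> norm x < 1 \<Longrightarrow> energy 0 < energy x"
proof -
  define I where "I = (LINT y:\<Omega>|lebesgue. F y)"
  define M where "M = energy 0 / I + 1"
  have I: "I > 0"
    using F_pos by (simp add: I_def)
  then have M: "energy 0 < M * I"
    by (simp add: M_def field_simps)
  have "eventually (\<lambda>\<rho>. M \<le> hyp_potential g \<rho>) (at_left 1)"
    using assms by (simp add: filterlim_at_top)
  then obtain b where b: "b < 1" "\<And>\<rho>. b < \<rho> \<Longrightarrow> \<rho> < 1 \<Longrightarrow> M \<le> hyp_potential g \<rho>"
    by (auto simp: eventually_at_left[OF zero_less_one])
  define c where "c = max b 0"
  have c: "0 \<le> c" "c < 1" "\<And>\<rho>. c < \<rho> \<Longrightarrow> \<rho> < 1 \<Longrightarrow> M \<le> hyp_potential g \<rho>"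
    using b by (auto simp: c_def)
  obtain R where R: "R < 1" "0 \<le> R" "\<And>y. y \<in> K \<Longrightarrow> norm y \<le> R"
  proof (cases "K = {}")
    case True
    then show ?thesis
      using that[of 0] by simp
  next
    case False
    have "continuous_on K norm"
      by (intro continuous_intros)
    from continuous_attains_sup[OF compact_K False this]
    obtain y0 where "y0 \<in> K" "\<And>y. y \<in> K \<Longrightarrow> norm y \<le> norm y0"
      by blast
    then show ?thesis
      using that[of "norm y0"] norm_K by simp
  qed
  define k where "k = (1 - c\<^sup>2) * (1 - R)\<^sup>2 / 2"
  have c2: "0 < 1 - c\<^sup>2" "1 - c\<^sup>2 \<le> 1"
    using c(1,2) by (auto simp: abs_square_less_1)
  have R2: "0 < (1 - R)\<^sup>2" "(1 - R)\<^sup>2 \<le> 1"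
    using R by (auto simp: power_le_one)
  have k: "0 < k" "k < 1" "k < (1 - c\<^sup>2) * (1 - R)\<^sup>2"
    using c2 R2 mult_le_one[of "1 - c\<^sup>2" "(1 - R)\<^sup>2"] by (auto simp: k_def)
  show thesis
  proof (rule that[of "sqrt (1 - k)"])
    show "0 \<le> sqrt (1 - k)" "sqrt (1 - k) < 1"
      using k by auto
    fix x :: "real ^ 'n" assume x: "sqrt (1 - k) < norm x" "norm x < 1"
    have "1 - k < (norm x)\<^sup>2"
      using power_strict_mono[OF x(1), of 2] k by simp
    have far: "M \<le> potential x y" if y: "y \<in> K" for y
    proof -
      have y1: "norm y < 1"
        using norm_K[OF y] .
      let ?T = "moebius_map x y" and ?D = "1 + 2 * (x \<bullet> y) + (norm x)\<^sup>2 * (norm y)\<^sup>2"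
      have "norm x * norm y \<le> 1 * R"
        using x(2) R(3)[OF y] by (intro mult_mono) auto
      then have "(1 - R)\<^sup>2 \<le> (1 - norm x * norm y)\<^sup>2"
        using R(1) by (intro power_mono) auto
      then have D: "(1 - R)\<^sup>2 \<le> ?D"
        using moebius_denominator_ge[of x y] by linarith
      have "1 - (norm ?T)\<^sup>2 = (1 - (norm x)\<^sup>2) * (1 - (norm y)\<^sup>2) / ?D"
        by (rule one_minus_norm_moebius_sq[OF x(2) y1])
      also have "\<dots> \<le> k * 1 / (1 - R)\<^sup>2"
        using D R2(1) k(1) \<open>1 - k < (norm x)\<^sup>2\<close> one_minus_norm_sq_pos[OF y1] one_minus_norm_sq_pos[OF x(2)]
        by (intro frac_le mult_mono) auto
      also have "\<dots> < 1 - c\<^sup>2"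
        using k(3) R2(1) by (simp add: pos_divide_less_eq)
      finally have "c\<^sup>2 < (norm ?T)\<^sup>2"
        by simp
      then have "c < norm ?T"
        by (rule power2_less_imp_less) simp
      then show ?thesis
        unfolding potential_def using c(3) norm_moebius_less_1[OF x(2) y1] by blast
    qed
    note M
    also have "M * I = (LINT y:\<Omega>|lebesgue. M * F y)"
      by (simp add: I_def)
    also have "\<dots> \<le> energy x"
      unfolding energy_def
    proof (rule set_integral_mono)
      show "M * F y \<le> F y * potential x y" if "y \<in> \<Omega>" for y
        using mult_left_mono[OF far F_nonneg[OF that]] that Omega_subset by (auto simp: mult.commute)
    qed (intro set_integrable_mult_right F_int set_integrable_potential x(2))+
    finally show "energy 0 < energy x" .
  qed
qed

lemma energy_minimum:
  assumes "filterlim (hyp_potential g) at_top (at_left 1)"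
  obtains x where "norm x < 1" "\<And>z. norm z < 1 \<Longrightarrow> energy x \<le> energy z"
proof -
  obtain r where r: "0 \<le> r" "r < 1" "\<And>x. r < norm x \<Longrightarrow> norm x < 1 \<Longrightarrow> energy 0 < energy x"
    using energy_coercive[OF assms] by blast
  have "cball (0 :: real ^ 'n) r \<noteq> {}"
    using r(1) by simp
  from continuous_attains_inf[OF compact_cball this continuous_on_energy[OF r(2)]]
  obtain x where x: "norm x \<le> r" "\<And>z. norm z \<le> r \<Longrightarrow> energy x \<le> energy z"
    by (auto simp: dist_norm)
  show thesis
  proof (rule that)
    show "norm x < 1"
      using x(1) r(2) by simp
    show "energy x \<le> energy z" if "norm z < 1" for z
      using x(2)[of z] x(2)[of 0] r(1) r(3)[OF _ that] by (cases "norm z \<le> r") auto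
  qed
qed

lemma force_eq_0_at_minimum:
  assumes x: "norm x < 1" and min: "\<And>z. norm z < 1 \<Longrightarrow> energy x \<le> energy z"
  shows "force x = 0"
proof (rule ccontr)
  assume "force x \<noteq> 0"
  define h where "h = - force x"
  have h: "norm h > 0"
    using \<open>force x \<noteq> 0\<close> by (simp add: h_def)
  define \<delta> where "\<delta> = (1 - norm x) / (2 * norm h)"
  have \<delta>: "0 < \<delta>"
    using h x by (simp add: \<delta>_def)
  have ray: "norm (x + s *\<^sub>R h) < 1" if "s \<in> {0..\<delta>}" for s
  proof -
    have "s * norm h \<le> \<delta> * norm h"
      using that h by (intro mult_right_mono) auto
    also have "\<dots> = (1 - norm x) / 2"
      using h by (simp add: \<delta>_def)
    finally show ?thesis
      using norm_triangle_ineq[of x "s *\<^sub>R h"] that x by simp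
  qed
  define \<psi> where "\<psi> s y = (radial_field g (moebius_map (x + s *\<^sub>R h) y) \<bullet> h) / (1 - (norm (x + s *\<^sub>R h))\<^sup>2)" for s y
  have "1 - (norm (x + s *\<^sub>R h))\<^sup>2 \<noteq> 0" if "s \<in> {0..\<delta>}" for s
    using one_minus_norm_sq_pos[OF ray[OF that]] by simp
  then have cont: "continuous_on ({0..\<delta>} \<times> K) (\<lambda>(s, y). \<psi> s y)"
    unfolding case_prod_beta \<psi>_def using ray norm_K
    by (intro continuous_on_divide continuous_on_inner continuous_on_field_compose continuous_intros) auto
  define I where "I = (LINT y:\<Omega>|lebesgue. F y)"
  have I: "I > 0"
    using F_pos by (simp add: I_def)
  have \<psi>0: "F y * \<psi> 0 y = ((F y *\<^sub>R radial_field g (moebius_map x y)) \<bullet> h) / (1 - (norm x)\<^sup>2)" for y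
    by (simp add: \<psi>_def)
  have int\<psi>: "set_integrable lebesgue \<Omega> (\<lambda>y. F y * \<psi> 0 y)"
    unfolding \<psi>0 by (intro set_integrable_divide set_integral_inner_left(2) set_integrable_field x)
  define a where "a = (LINT y:\<Omega>|lebesgue. F y * \<psi> 0 y)"
  have "a = (force x \<bullet> h) / (1 - (norm x)\<^sup>2)"
    unfolding a_def \<psi>0 set_integral_divide_zero set_integral_inner_left(1)[OF set_integrable_field[OF x]] force_def ..
  also have "force x \<bullet> h = - (norm h)\<^sup>2"
    by (simp add: h_def power2_norm_eq_inner)
  finally have a: "a < 0"
    using h one_minus_norm_sq_pos[OF x] by (simp add: divide_neg_pos)
  define \<epsilon> where "\<epsilon> = - a / (2 * I)"
  have \<epsilon>: "\<epsilon> > 0" "\<epsilon> * I = - a / 2"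
    using a I by (auto simp: \<epsilon>_def divide_neg_pos)
  obtain d where d: "d > 0" "\<And>p q. p \<in> {0..\<delta>} \<times> K \<Longrightarrow> q \<in> {0..\<delta>} \<times> K \<Longrightarrow> dist q p < d \<Longrightarrow>
      dist ((\<lambda>(s, y). \<psi> s y) q) ((\<lambda>(s, y). \<psi> s y) p) < \<epsilon>"
    using compact_uniformly_continuous[OF cont compact_Times[OF compact_Icc compact_K]] \<epsilon>(1)
    unfolding uniformly_continuous_on_def by metis
  define t where "t = min (d / 2) \<delta>"
  have t: "0 < t" "t < d" "t \<le> \<delta>"
    using d(1) \<delta> by (auto simp: t_def)
  have step: "potential (x + t *\<^sub>R h) y - potential x y \<le> t * (\<psi> 0 y + \<epsilon>)" if y: "y \<in> K" for y
  proof -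
    define S where "S = {s. x + s *\<^sub>R h = - y}"
    have "inj (\<lambda>s. x + s *\<^sub>R h)"
      using h by (auto simp: inj_def)
    then have S: "finite S"
      using finite_vimageI[of "{- y}" "\<lambda>s. x + s *\<^sub>R h"] by (simp add: S_def vimage_def)
    have deriv: "((\<lambda>s. potential (x + s *\<^sub>R h) y) has_vector_derivative \<psi> s y) (at s)"
      if s: "s \<in> {0<..<t} - S" for s
    proof -
      have s1: "norm (x + s *\<^sub>R h) < 1"
        using s t by (intro ray) auto
      have "moebius_map (x + s *\<^sub>R h) y \<noteq> 0"
        using s moebius_eq_0_iff[OF s1 norm_K[OF y]] by (auto simp: S_def)
      from has_real_derivative_hyp_potential_moebius[OF cont_g s1 norm_K[OF y] this]
      show ?thesis
        unfolding potential_def \<psi>_def by (simp only: has_real_derivative_iff_has_vector_derivative)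
    qed
    have "continuous_on {0..t} (\<lambda>s. potential (x + s *\<^sub>R h) y)"
      using ray t norm_K[OF y] by (intro continuous_on_potential_compose continuous_intros) auto
    from fundamental_theorem_of_calculus_interior_strong[OF S less_imp_le[OF t(1)] deriv this]
    have int: "((\<lambda>s. \<psi> s y) has_integral potential (x + t *\<^sub>R h) y - potential x y) {0..t}"
      by simp
    have "((\<lambda>s. \<psi> 0 y + \<epsilon>) has_integral t * (\<psi> 0 y + \<epsilon>)) {0..t}"
      using has_integral_const_real[of "\<psi> 0 y + \<epsilon>" 0 t] t(1) by simp
    with int show ?thesis
    proof (rule has_integral_le)
      show "\<psi> s y \<le> \<psi> 0 y + \<epsilon>" if s: "s \<in> {0..t}" for s
        using d(2)[of "(0, y)" "(s, y)"] s t y \<delta> by (auto simp: dist_Pair_Pair dist_real_def)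
    qed
  qed
  have xt: "norm (x + t *\<^sub>R h) < 1"
    using t by (intro ray) auto
  note ints = set_integrable_potential[OF xt] set_integrable_potential[OF x]
  have rhs: "set_integrable lebesgue \<Omega> (\<lambda>y. t * (F y * \<psi> 0 y + \<epsilon> * F y))"
    by (intro set_integrable_mult_right set_integral_add(1) int\<psi> F_int)
  have "energy (x + t *\<^sub>R h) - energy x
      = (LINT y:\<Omega>|lebesgue. F y * potential (x + t *\<^sub>R h) y - F y * potential x y)"
    unfolding energy_def set_integral_diff(2)[OF ints] ..
  also have "\<dots> \<le> (LINT y:\<Omega>|lebesgue. t * (F y * \<psi> 0 y + \<epsilon> * F y))"
  proof (rule set_integral_mono[OF set_integral_diff(1)[OF ints] rhs])
    fix y assume y: "y \<in> \<Omega>"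
    show "F y * potential (x + t *\<^sub>R h) y - F y * potential x y \<le> t * (F y * \<psi> 0 y + \<epsilon> * F y)"
      using mult_left_mono[OF step F_nonneg[OF y]] y Omega_subset by (auto simp: algebra_simps)
  qed
  also have "\<dots> = t * (a + \<epsilon> * I)"
    unfolding set_integral_mult_right set_integral_add(2)[OF int\<psi> set_integrable_mult_right[OF F_int]] a_def I_def ..
  also have "\<dots> < 0"
    using t(1) a by (simp add: \<epsilon>(2) mult_pos_neg)
  finally show False
    using min[OF xt] by simp
qed

end

section \<open>Uniqueness\<close>

lemma negligible_hyp_log_orthogonal:
  fixes x u :: "real ^ 'n"
  assumes x: "norm x < 1" and u: "u \<noteq> 0"
  shows "negligible {y. norm y < 1 \<and> hyp_log x y \<bullet> u = 0}"
proof -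
  let ?N = "{y. norm y < 1 \<and> hyp_log x y \<bullet> u = 0}"
  define a where "a = 1 - (norm x)\<^sup>2"
  have a: "a > 0"
    using one_minus_norm_sq_pos[OF x] by (simp add: a_def)
  have eq: "(1 + 2 * (x \<bullet> y) + (norm y)\<^sup>2) * (x \<bullet> u) + a * (y \<bullet> u) = 0" if "y \<in> ?N" for y
  proof -
    have y: "norm y < 1" "hyp_log x y \<bullet> u = 0"
      using that by auto
    then have "2 / (a * (1 - (norm y)\<^sup>2)) * ((1 + 2 * (x \<bullet> y) + (norm y)\<^sup>2) * (x \<bullet> u) + a * (y \<bullet> u)) = 0"
      by (simp only: hyp_log_eq[OF x y(1)] inner_scaleR_left inner_add_left a_def)
    moreover have "0 < 2 / (a * (1 - (norm y)\<^sup>2))"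
      using a one_minus_norm_sq_pos[OF y(1)] by (intro divide_pos_pos mult_pos_pos) auto
    ultimately show ?thesis
      by (metis less_irrefl mult_eq_0_iff)
  qed
  show ?thesis
  proof (cases "x \<bullet> u = 0")
    case True
    then have "?N \<subseteq> {y. u \<bullet> y = 0}"
      using eq a by (auto simp: inner_commute)
    moreover have "negligible {y. u \<bullet> y = 0}"
      using u by (simp add: negligible_hyperplane)
    ultimately show ?thesis
      by (rule negligible_subset[rotated])
  next
    case False
    define m where "m = x + (a / (2 * (x \<bullet> u))) *\<^sub>R u"
    have "y \<in> sphere (- m) (sqrt ((norm m)\<^sup>2 - 1))" if y: "y \<in> ?N" for y
    proof -
      have "(x \<bullet> u) * (2 * (y \<bullet> m)) = (x \<bullet> u) * (2 * (x \<bullet> y)) + a * (y \<bullet> u)"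
        using False by (simp add: m_def inner_add_right inner_commute[of y x] distrib_left)
      then have "(x \<bullet> u) * (1 + 2 * (y \<bullet> m) + (norm y)\<^sup>2) = 0"
        using eq[OF y] by (simp add: algebra_simps)
      then have "(norm (m + y))\<^sup>2 = (norm m)\<^sup>2 - 1"
        using False by (simp add: power2_norm_eq_inner inner_add_left inner_add_right inner_commute[of m y])
      then have "norm (m + y) = sqrt ((norm m)\<^sup>2 - 1)"
        by (metis abs_norm_cancel real_sqrt_abs)
      then show ?thesis
        by (simp add: dist_norm norm_minus_commute add.commute)
    qed
    then have "?N \<subseteq> sphere (- m) (sqrt ((norm m)\<^sup>2 - 1))"
      by blast
    then show ?thesis
      by (rule negligible_subset[OF negligible_sphere])
  qed
qed

lemma field_inner_sum_pos:
  fixes x x' y :: "real ^ 'n"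
  assumes x: "norm x < 1" and x': "norm x' < 1" and y: "norm y < 1"
    and ne: "x \<noteq> x'" "y \<noteq> - x" "y \<noteq> - x'"
    and mono: "mono_on {0..<1} g" and pos: "\<And>r. 0 < r \<Longrightarrow> r < 1 \<Longrightarrow> 0 < g r"
    and strict: "strict_mono_on {0..<1} g \<or>
      \<bar>hyp_log x y \<bullet> hyp_log x (- x')\<bar> \<noteq> norm (hyp_log x y) * norm (hyp_log x (- x'))"
  shows "0 < radial_field g (moebius_map x y) \<bullet> hyp_log x (- x') +
    radial_field g (moebius_map x' y) \<bullet> hyp_log x' (- x)"
proof -
  define c C C' where "c = hyp_cosh x (- x')" and "C = hyp_cosh x y" and "C' = hyp_cosh x' y"
  define r r' where "r = norm (moebius_map x y)" and "r' = norm (moebius_map x' y)"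
  have mx: "norm (- x) < 1" "norm (- x') < 1"
    using x x' by simp_all
  have c_eq: "hyp_cosh x' (- x) = c"
    unfolding c_def by (metis hyp_cosh_commute hyp_cosh_minus)
  have inner: "hyp_log x y \<bullet> hyp_log x (- x') = c * C - C'"
    "hyp_log x' y \<bullet> hyp_log x' (- x) = c * C' - C"
    unfolding hyp_cosine_rule[OF x y mx(2)] hyp_cosine_rule[OF x' y mx(1)] c_eq
    by (simp_all add: c_def C_def C'_def hyp_cosh_commute[of y])
  have gt: "1 < c" "1 < C" "1 < C'"
    using hyp_cosh_gt_1[OF x mx(2)] hyp_cosh_gt_1[OF x y] hyp_cosh_gt_1[OF x' y] ne
    by (auto simp: c_def C_def C'_def)
  have r: "0 < r" "r < 1" and r': "0 < r'" "r' < 1"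
    using ne moebius_eq_0_iff[OF x y] moebius_eq_0_iff[OF x' y]
      norm_moebius_less_1[OF x y] norm_moebius_less_1[OF x' y] by (auto simp: r_def r'_def)
  have less: "C < C' \<longleftrightarrow> r < r'" "C' < C \<longleftrightarrow> r' < r"
    unfolding C_def C'_def r_def r'_def
    using hyp_cosh_less_iff x x' y by blast+
  have swap: "(C\<^sup>2 - 1) * (C'\<^sup>2 - 1) - (C * C' - c)\<^sup>2 =
      (norm (hyp_log x y))\<^sup>2 * (norm (hyp_log x (- x')))\<^sup>2 - (hyp_log x y \<bullet> hyp_log x (- x'))\<^sup>2"
    unfolding inner norm_hyp_log_sq[OF x y] norm_hyp_log_sq[OF x mx(2)] c_def[symmetric] C_def[symmetric]
    by algebra
  let ?i = "hyp_log x y \<bullet> hyp_log x (- x')" and ?n = "norm (hyp_log x y) * norm (hyp_log x (- x'))"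
  have CS: "\<bar>?i\<bar> \<le> ?n"
    by (rule Cauchy_Schwarz_ineq2)
  have "?i\<^sup>2 \<le> ?n\<^sup>2"
    using CS by (metis abs_ge_zero power2_abs power_mono)
  then have gram: "(C * C' - c)\<^sup>2 \<le> (C\<^sup>2 - 1) * (C'\<^sup>2 - 1)"
    using swap by (simp add: power_mult_distrib)
  have gram_strict: "(C * C' - c)\<^sup>2 < (C\<^sup>2 - 1) * (C'\<^sup>2 - 1)" if "\<bar>?i\<bar> \<noteq> ?n"
  proof -
    have "\<bar>?i\<bar> < ?n"
      using CS that by simp
    then have "?i\<^sup>2 < ?n\<^sup>2"
      by (metis abs_ge_zero power2_abs power_strict_mono zero_less_numeral)
    then show ?thesis
      using swap by (simp add: power_mult_distrib)
  qed
  have "0 < g r * ((c * C - C') / sqrt (C\<^sup>2 - 1)) + g r' * ((c * C' - C) / sqrt (C'\<^sup>2 - 1))"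
  proof (rule triangle_monotone_ineq[OF gt gram])
    show "0 < g r" "0 < g r'"
      using pos r r' by blast+
    show "C < C' \<Longrightarrow> g r \<le> g r'" "C' < C \<Longrightarrow> g r' \<le> g r"
      unfolding less using r r' by (auto intro!: mono_onD[OF mono])
    show "(C * C' - c)\<^sup>2 < (C\<^sup>2 - 1) * (C'\<^sup>2 - 1) \<or> (C < C' \<longrightarrow> g r < g r') \<and> (C' < C \<longrightarrow> g r' < g r)"
      using strict
    proof
      assume "strict_mono_on {0..<1} g"
      then show ?thesis
        unfolding less using r r' by (auto intro: strict_mono_onD)
    qed (use gram_strict in blast)
  qed
  then show ?thesis
    unfolding radial_field_moebius_inner[OF x y] radial_field_moebius_inner[OF x' y] inner
    by (simp add: C_def C'_def r_def r'_def)
qed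

context hyperbolic_weight
begin

lemma force_zero_unique:
  assumes x: "norm x < 1" "force x = 0" and x': "norm x' < 1" "force x' = 0"
    and mono: "mono_on {0..<1} g" and pos: "\<And>r. 0 < r \<Longrightarrow> r < 1 \<Longrightarrow> 0 < g r"
    and strict: "CARD('n) = 1 \<Longrightarrow> strict_mono_on {0..<1} g"
  shows "x = x'"
proof (rule ccontr)
  assume ne: "x \<noteq> x'"
  define w w' where "w = hyp_log x (- x')" and "w' = hyp_log x' (- x)"
  have "1 < hyp_cosh x (- x')"
    using x(1) x'(1) ne by (intro hyp_cosh_gt_1) auto
  then have "1 < (hyp_cosh x (- x'))\<^sup>2"
    by (simp add: one_less_power)
  then have "0 < (norm w)\<^sup>2"
    unfolding w_def using norm_hyp_log_sq[of x "- x'"] x(1) x'(1) by simp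
  then have w: "w \<noteq> 0"
    by auto
  define P where "P y = radial_field g (moebius_map x y) \<bullet> w + radial_field g (moebius_map x' y) \<bullet> w'" for y
  obtain N where N: "negligible N"
    and strict': "\<And>y. y \<notin> N \<Longrightarrow> norm y < 1 \<Longrightarrow>
      strict_mono_on {0..<1} g \<or> \<bar>hyp_log x y \<bullet> w\<bar> \<noteq> norm (hyp_log x y) * norm w"
  proof (cases "CARD('n) = 1")
    case True
    then show ?thesis
      using that[of "{}"] strict by simp
  next
    case False
    have "2 \<le> CARD('n)"
      using False zero_less_card_finite[where 'a = 'n] by linarith
    then have "2 \<le> DIM(real ^ 'n)"
      by simp
    then obtain u :: "real ^ 'n" where u: "u \<noteq> 0" "orthogonal w u"
      by (rule orthogonal_to_vector_exists)
    show ?thesis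
    proof (rule that)
      show "negligible {y. norm y < 1 \<and> hyp_log x y \<bullet> u = 0}"
        by (rule negligible_hyp_log_orthogonal[OF x(1) u(1)])
      fix y assume y: "y \<notin> {y. norm y < 1 \<and> hyp_log x y \<bullet> u = 0}" "norm y < 1"
      have "\<bar>hyp_log x y \<bullet> w\<bar> \<noteq> norm (hyp_log x y) * norm w"
      proof
        assume "\<bar>hyp_log x y \<bullet> w\<bar> = norm (hyp_log x y) * norm w"
        then have "norm (hyp_log x y) *\<^sub>R w = norm w *\<^sub>R hyp_log x y \<or> norm (hyp_log x y) *\<^sub>R w = - norm w *\<^sub>R hyp_log x y"
          by (simp only: norm_cauchy_schwarz_abs_eq)
        then have "(norm (hyp_log x y) *\<^sub>R w) \<bullet> u = (norm w *\<^sub>R hyp_log x y) \<bullet> u \<or>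
            (norm (hyp_log x y) *\<^sub>R w) \<bullet> u = (- norm w *\<^sub>R hyp_log x y) \<bullet> u"
          by metis
        then have "norm w * (hyp_log x y \<bullet> u) = 0"
          using u(2) by (auto simp: orthogonal_def)
        then show False
          using w y by simp
      qed
      then show "strict_mono_on {0..<1} g \<or> \<bar>hyp_log x y \<bullet> w\<bar> \<noteq> norm (hyp_log x y) * norm w" ..
    qed
  qed
  have "negligible (N \<union> {- x, - x'})"
    using N by (simp add: negligible_Un)
  then have "AE y in lebesgue. y \<notin> N \<union> {- x, - x'}"
    by (intro AE_not_in) (simp add: negligible_iff_null_sets)
  then have P_pos: "AE y in lebesgue. y \<in> \<Omega> \<longrightarrow> 0 < P y"
  proof eventually_elim
    case (elim y)
    show ?case
    proof
      assume "y \<in> \<Omega>"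
      then have y: "norm y < 1"
        using Omega_subset norm_K by blast
      show "0 < P y"
        unfolding P_def w_def w'_def
        using elim strict'[OF _ y, unfolded w_def]
        by (intro field_inner_sum_pos[OF x(1) x'(1) y ne _ _ mono pos]) auto
    qed
  qed
  note int = set_integrable_field[OF x(1)] set_integrable_field[OF x'(1)]
  have FP: "F y * P y = (F y *\<^sub>R radial_field g (moebius_map x y)) \<bullet> w +
      (F y *\<^sub>R radial_field g (moebius_map x' y)) \<bullet> w'" for y
    by (simp add: P_def distrib_left)
  have int_FP: "set_integrable lebesgue \<Omega> (\<lambda>y. F y * P y)"
    unfolding FP by (intro set_integral_add(1) set_integral_inner_left(2) int)
  have "(LINT y:\<Omega>|lebesgue. F y * P y) = force x \<bullet> w + force x' \<bullet> w'"
    unfolding FP force_def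
    by (simp only: set_integral_add(2)[OF set_integral_inner_left(2)[OF int(1)] set_integral_inner_left(2)[OF int(2)]]
        set_integral_inner_left(1)[OF int(1)] set_integral_inner_left(1)[OF int(2)])
  then have zero: "(\<integral>y. indicator \<Omega> y *\<^sub>R (F y * P y) \<partial>lebesgue) = 0"
    by (simp add: x(2) x'(2) set_lebesgue_integral_def)
  have nonneg: "AE y in lebesgue. 0 \<le> indicator \<Omega> y *\<^sub>R (F y * P y)"
    using P_pos
  proof eventually_elim
    case (elim y)
    then show ?case
      using mult_nonneg_nonneg[OF F_nonneg less_imp_le, of y "P y"] by (cases "y \<in> \<Omega>") simp_all
  qed
  have "AE y in lebesgue. indicator \<Omega> y *\<^sub>R (F y * P y) = 0"
    using zero integral_nonneg_eq_0_iff_AE[OF int_FP[unfolded set_integrable_def] nonneg] by simp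
  with P_pos have "AE y in lebesgue. indicator \<Omega> y *\<^sub>R F y = 0"
    by eventually_elim (auto simp: indicator_def)
  then have "(LINT y:\<Omega>|lebesgue. F y) = 0"
    unfolding set_lebesgue_integral_def by (rule integral_eq_zero_AE)
  then show False
    using F_pos by simp
qed

end

theorem corollary2:
  fixes g :: "real \<Rightarrow> real"
    and f :: "real ^ 'n \<Rightarrow> real"
    and \<Omega> :: "(real ^ 'n) set"
  assumes "continuous_on {0..<1} g"
    and "g 0 = 0"
    and "open \<Omega>"
    and "compact (closure \<Omega>)"
    and "closure \<Omega> \<subseteq> ball 0 1"
    and "\<And>y. y \<in> \<Omega> \<Longrightarrow> 0 \<le> f y"
    and "set_integrable lebesgue \<Omega> (\<lambda>y. f y * hyp_density y)"
    and "0 < (LINT y:\<Omega>|lebesgue. f y * hyp_density y)"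
    and "filterlim (\<lambda>\<rho>. integral {0..\<rho>} (\<lambda>r. g r / (1 - r\<^sup>2))) at_top (at_left 1)"
  shows "(\<exists>x\<in>ball 0 1.
            set_integrable lebesgue \<Omega>
              (\<lambda>y. (f y * hyp_density y) *\<^sub>R radial_field g (moebius_map x y)) \<and>
            (LINT y:\<Omega>|lebesgue. (f y * hyp_density y) *\<^sub>R radial_field g (moebius_map x y)) = 0) \<and>
         (mono_on {0..<1} g \<and> (\<forall>r. 0 < r \<and> r < 1 \<longrightarrow> 0 < g r) \<and>
            (CARD('n) = 1 \<longrightarrow> strict_mono_on {0..<1} g) \<longrightarrow>
          (\<exists>!x. x \<in> ball 0 1 \<and>
            (LINT y:\<Omega>|lebesgue. (f y * hyp_density y) *\<^sub>R radial_field g (moebius_map x y)) = 0))"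
proof -
  interpret hyperbolic_weight g "\<lambda>y. f y * hyp_density y" \<Omega> "closure \<Omega>"
  proof
    show "0 \<le> f y * hyp_density y" if "y \<in> \<Omega>" for y
    proof -
      have "norm y < 1"
        using that assms(5) closure_subset[of \<Omega>] by auto
      then show ?thesis
        using assms(6)[OF that] one_minus_norm_sq_pos[of y] by (simp add: hyp_density_def)
    qed
  qed (use assms closure_subset in auto)
  have "filterlim (hyp_potential g) at_top (at_left 1)"
    unfolding hyp_potential_def by (rule assms(9))
  then obtain x where x: "norm x < 1" "force x = 0"
    using energy_minimum force_eq_0_at_minimum by metis
  show ?thesis
  proof (intro conjI impI)
    show "\<exists>x\<in>ball 0 1. set_integrable lebesgue \<Omega>
        (\<lambda>y. (f y * hyp_density y) *\<^sub>R radial_field g (moebius_map x y)) \<and>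
      (LINT y:\<Omega>|lebesgue. (f y * hyp_density y) *\<^sub>R radial_field g (moebius_map x y)) = 0"
      using x set_integrable_field[OF x(1)] unfolding force_def by auto
    assume *: "mono_on {0..<1} g \<and> (\<forall>r. 0 < r \<and> r < 1 \<longrightarrow> 0 < g r) \<and>
      (CARD('n) = 1 \<longrightarrow> strict_mono_on {0..<1} g)"
    have "z = x" if "norm z < 1" "force z = 0" for z
      using force_zero_unique[OF that x] * by blast
    then show "\<exists>!x. x \<in> ball 0 1 \<and>
      (LINT y:\<Omega>|lebesgue. (f y * hyp_density y) *\<^sub>R radial_field g (moebius_map x y)) = 0"
      using x unfolding force_def by auto
  qed
qed

end
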